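(* Let $q$ be a prime power, $2\le n\le m$, and let $\mathcal{C}_1,\mathcal{C}_2\subseteq\mathrm{Mat}$ be rank-metric codes with $\mathcal{C}_1\sim\mathcal{C}_2$. If $m>n$, then $P(\mathcal{C}_1,\mathrm c)\sim P(\mathcal{C}_2,\mathrm c)$ and $P(\mathcal{C}_1,\mathrm r)\sim P(\mathcal{C}_2,\mathrm r)$. If $n=m$, then either $P(\mathcal{C}_1,\mathrm c)\sim P(\mathcal{C}_2,\mathrm c)$ and $P(\mathcal{C}_1,\mathrm r)\sim P(\mathcal{C}_2,\mathrm r)$, or $P(\mathcal{C}_1,\mathrm c)\sim P(\mathcal{C}_2,\mathrm r)$ and $P(\mathcal{C}_1,\mathrm r)\sim P(\mathcal{C}_2,\mathrm c)$.
   Context: $\mathrm{Mat}$ is the $\mathbb{F}_q$-space of $n\times m$ matrices over $\mathbb{F}_q$; a rank-metric code is an $\mathbb{F}_q$-linear subspace. Codes are equivalent ($\mathcal{C}_1\sim\mathcal{C}_2$) if there is an $\mathbb{F}_q$-linear isometry $f:\mathrm{Mat}\to\mathrm{Mat}$ for the rank metric $d(M,N)=\mathrm{rk}(M-N)$ with $f(\mathcal{C}_1)=\mathcal{C}_2$. For subspaces $J\subseteq\mathbb{F}_q^n$, $K\subseteq\mathbb{F}_q^m$: $\mathcal{C}(J,\mathrm c)=\{M\in\mathcal{C}\mid\mathrm{colsp}(M)\subseteq J\}$, $\mathcal{C}(K,\mathrm r)=\{M\in\mathcal{C}\mid\mathrm{rowsp}(M)\subseteq K\}$, $\rho_{\mathrm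 c}(\mathcal{C},J)=(\dim\mathcal{C}-\dim\mathcal{C}(J^\perp,\mathrm c))/m$, $\rho_{\mathrm r}(\mathcal{C},K)=(\dim\mathcal{C}-\dim\mathcal{C}(K^\perp,\mathrm r))/n$ ($\perp$ for the standard inner product). $P(\mathcal{C},\mathrm c)=(\mathbb{F}_q^n,\rho_{\mathrm c}(\mathcal{C},\cdot))$ and $P(\mathcal{C},\mathrm r)=(\mathbb{F}_q^m,\rho_{\mathrm r}(\mathcal{C},\cdot))$ (these are $q$-polymatroids). Two pairs $(\mathbb{F}_q^N,\rho_1)$, $(\mathbb{F}_q^N,\rho_2)$ are equivalent ($\sim$) if there is an $\mathbb{F}_q$-linear isomorphism $\varphi:\mathbb{F}_q^N\to\mathbb{F}_q^N$ with $\rho_1(A)=\rho_2(\varphi(A))$ for all subspaces $A$. *)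

theory Defs
  imports "HOL-Analysis.Analysis"
begin

text \<open>Matrices in Mat are of type 'a^'m^'n : n = CARD('n) rows, m = CARD('m) columns,
  over a finite field 'a (so q = CARD('a) is a prime power).\<close>

definition mat_scale :: "'a::field \<Rightarrow> 'a^'m^'n \<Rightarrow> 'a^'m^'n" where
  "mat_scale c M = (\<chi> i j. c * M $ i $ j)"

text \<open>F_q-dimension of a set of matrices (the vector space Mat with scalar mat_scale).\<close>
definition mat_dim :: "('a::field^'m^'n) set \<Rightarrow> nat" where
  "mat_dim C = vector_space.dim (mat_scale :: 'a \<Rightarrow> 'a^'m^'n \<Rightarrow> 'a^'m^'n) C"

definition rank_metric_code :: "('a::field^'m^'n) set \<Rightarrow> bool" where
  "rank_metric_code C = module.subspace (mat_scale :: 'a \<Rightarrow> 'a^'m^'n \<Rightarrow> 'a^'m^'n) C"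

definition code_equiv :: "('a::field^'m^'n) set \<Rightarrow> ('a^'m^'n) set \<Rightarrow> bool" where
  "code_equiv C1 C2 \<longleftrightarrow> (\<exists>f :: 'a^'m^'n \<Rightarrow> 'a^'m^'n.
      Vector_Spaces.linear mat_scale mat_scale f \<and>
      (\<forall>M N. rank (f M - f N) = rank (M - N)) \<and> f ` C1 = C2)"

definition dotp :: "'a::field^'k \<Rightarrow> 'a^'k \<Rightarrow> 'a" where
  "dotp u v = (\<Sum>i\<in>UNIV. u $ i * v $ i)"

definition orth :: "('a::field^'k) set \<Rightarrow> ('a^'k) set" where
  "orth J = {v. \<forall>u\<in>J. dotp u v = 0}"

definition colsp :: "'a::field^'m^'n \<Rightarrow> ('a^'n) set" where
  "colsp M = vec.span (columns M)"

definition rowsp :: "'a::field^'m^'n \<Rightarrow> ('a^'m) set" where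
  "rowsp M = vec.span (rows M)"

definition sub_c :: "('a::field^'m^'n) set \<Rightarrow> ('a^'n) set \<Rightarrow> ('a^'m^'n) set" where
  "sub_c C J = {M\<in>C. colsp M \<subseteq> J}"

definition sub_r :: "('a::field^'m^'n) set \<Rightarrow> ('a^'m) set \<Rightarrow> ('a^'m^'n) set" where
  "sub_r C K = {M\<in>C. rowsp M \<subseteq> K}"

definition rho_c :: "('a::field^'m^'n) set \<Rightarrow> ('a^'n) set \<Rightarrow> real" where
  "rho_c C J = (real (mat_dim C) - real (mat_dim (sub_c C (orth J)))) / real CARD('m)"

definition rho_r :: "('a::field^'m^'n) set \<Rightarrow> ('a^'m) set \<Rightarrow> real" where
  "rho_r C K = (real (mat_dim C) - real (mat_dim (sub_r C (orth K)))) / real CARD('n)"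

text \<open>Equivalence of pairs (F_q^N, rho1), (F_q^N, rho2): a linear bijection phi with
  rho1 A = rho2 (phi A) for all subspaces A.  The two copies of F_q^N may be indexed
  by different (equicardinal) index types, which is needed when n = m but the
  row and column index types differ.\<close>
definition qpm_equiv :: "(('a::field^'k) set \<Rightarrow> real) \<Rightarrow> (('a^'l) set \<Rightarrow> real) \<Rightarrow> bool" where
  "qpm_equiv rho1 rho2 \<longleftrightarrow> (\<exists>\<phi> :: 'a^'k \<Rightarrow> 'a^'l.
      Vector_Spaces.linear (*s) (*s) \<phi> \<and> bij \<phi> \<and>
      (\<forall>A. vec.subspace A \<longrightarrow> rho1 A = rho2 (\<phi> ` A)))"

end

(* A linear rank isometry f preserves the rank-one matrices, and every additive set of
   rank-one matrices consists of outer products u w^T with a common left factor u or a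
   common right factor w.  Comparing the images of the two kinds of such families shows that
   f either respects both kinds or exchanges them; exchanging them injects a set of size
   q^m into one of size q^n, so it forces n = m.  If f respects both kinds, then
   f (u w0^T) = psi(u) w'^T for a linear bijection psi, hence f maps the matrices with
   column space in V onto those with column space in psi(V).  As sub_c is taken over
   orthogonal complements, the column q-polymatroids of C and f(C) then correspond under
   the transpose of psi^-1.  Rows reduce to columns by transposition, and the exchanging
   case to the respecting one by composing f with transposition. *)

theory Submission
  imports Defs
begin

interpretation mat: vector_space "mat_scale :: 'a::field \<Rightarrow> 'a^'m^'n \<Rightarrow> _"
  by unfold_locales (auto simp: mat_scale_def vec_eq_iff algebra_simps)

interpretation mat: vector_space_pair "mat_scale :: 'a::field \<Rightarrow> 'a^'m^'n \<Rightarrow> _"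
  "mat_scale :: 'a \<Rightarrow> 'a^'m2^'n2 \<Rightarrow> _" ..

section \<open>Outer products and rank-one matrices\<close>

definition outer_prod :: "'a::field^'n \<Rightarrow> 'a^'m \<Rightarrow> 'a^'m^'n" where
  "outer_prod x w = (\<chi> i j. x$i * w$j)"

definition left_outers :: "'a::field^'n \<Rightarrow> ('a^'m^'n) set" where
  "left_outers u = range (outer_prod u)"

definition right_outers :: "'a::field^'m \<Rightarrow> ('a^'m^'n) set" where
  "right_outers w = range (\<lambda>x. outer_prod x w)"

definition parallel :: "'a::field^'n \<Rightarrow> 'a^'n \<Rightarrow> bool" where
  "parallel x y \<longleftrightarrow> (\<forall>i k. x$i * y$k = x$k * y$i)"

lemma outer_prod_nth [simp]: "outer_prod x w $ i $ j = x$i * w$j"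
  by (simp add: outer_prod_def)

lemma outer_prod_add_left: "outer_prod (x + y) w = outer_prod x w + outer_prod y w"
  by (simp add: vec_eq_iff algebra_simps)

lemma outer_prod_add_right: "outer_prod x (w + z) = outer_prod x w + outer_prod x z"
  by (simp add: vec_eq_iff algebra_simps)

lemma outer_prod_0_left [simp]: "outer_prod 0 w = 0"
  by (simp add: vec_eq_iff)

lemma outer_prod_0_right [simp]: "outer_prod x 0 = 0"
  by (simp add: vec_eq_iff)

lemma outer_prod_eq_0_iff [simp]: "outer_prod x w = 0 \<longleftrightarrow> x = 0 \<or> w = 0"
  by (auto simp: vec_eq_iff)

lemma transpose_outer_prod: "transpose (outer_prod x w) = outer_prod w x"
  by (simp add: vec_eq_iff transpose_def mult.commute)

lemma column_outer_prod: "column j (outer_prod x w) = w$j *s x"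
  by (simp add: vec_eq_iff column_def mult.commute)

lemma linear_outer_prod_left: "Vector_Spaces.linear (*s) mat_scale (\<lambda>x. outer_prod x w)"
  unfolding Vector_Spaces.linear_iff
  by (intro conjI vec.vector_space_axioms mat.vector_space_axioms allI)
    (simp_all add: outer_prod_add_left vec_eq_iff mat_scale_def)

lemma inj_outer_prod_left:
  fixes w :: "'a::field^'m"
  assumes "w \<noteq> 0" shows "inj (\<lambda>x :: 'a^'n. outer_prod x w)"
proof (rule injI)
  obtain j where j: "w$j \<noteq> 0" using assms by (auto simp: vec_eq_iff)
  fix x y :: "'a^'n" assume "outer_prod x w = outer_prod y w"
  then have "x$i * w$j = y$i * w$j" for i by (metis outer_prod_nth)
  then show "x = y" using j by (simp add: vec_eq_iff)
qed

lemma inj_outer_prod_right: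
  fixes u :: "'a::field^'n"
  assumes "u \<noteq> 0" shows "inj (outer_prod u :: 'a^'m \<Rightarrow> 'a^'m^'n)"
proof (rule injI)
  obtain i where i: "u$i \<noteq> 0" using assms by (auto simp: vec_eq_iff)
  fix w z :: "'a^'m" assume "outer_prod u w = outer_prod u z"
  then have "u$i * w$j = u$i * z$j" for j by (metis outer_prod_nth)
  then show "w = z" using i by (simp add: vec_eq_iff)
qed

lemma rows_subset_0_iff: "rows M \<subseteq> {0} \<longleftrightarrow> M = 0"
proof
  assume "rows M \<subseteq> {0}"
  then have "row i M = 0" for i by (auto simp: rows_def)
  then show "M = 0" by (simp add: row_def vec_eq_iff)
qed (auto simp: rows_def row_def vec_eq_iff)

lemma rank_eq_0_iff: "rank (M::'a::field^'m^'n) = 0 \<longleftrightarrow> M = 0"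
  by (simp add: row_rank_def_gen rows_subset_0_iff)

lemma rank_le_one_iff: "rank (M::'a::{finite,field}^'m^'n) \<le> 1 \<longleftrightarrow> (\<exists>x w. M = outer_prod x w)"
proof
  assume "\<exists>x w. M = outer_prod x w"
  then obtain x w where M: "M = outer_prod x w" by blast
  have "rows M \<subseteq> vec.span {w}"
    by (auto simp: M rows_def row_def vec.span_singleton vec_eq_iff)
  then have "vec.dim (rows M) \<le> card {w}" by (intro vec.dim_le_card) auto
  then show "rank M \<le> 1" by (simp add: row_rank_def_gen)
next
  assume r: "rank M \<le> 1"
  obtain B where B: "B \<subseteq> rows M" "vec.independent B" "rows M \<subseteq> vec.span B"
    "card B = vec.dim (rows M)"
    using vec.basis_exists by blast
  have fin: "finite B" by simp
  have "card B \<le> Suc 0" using r B(4) by (simp add: row_rank_def_gen)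
  then have "\<forall>a\<in>B. \<forall>b\<in>B. a = b" using card_le_Suc0_iff_eq[OF fin] by blast
  then obtain w where "B \<subseteq> {w}" by blast
  then have "rows M \<subseteq> vec.span {w}" using B(3) vec.span_mono by blast
  then have "\<forall>i. \<exists>c. M$i = c *s w"
    by (auto simp: rows_def row_def vec.span_singleton)
  then obtain c where c: "\<And>i. M$i = c i *s w" by metis
  have "M = outer_prod (\<chi> i. c i) w" using c by (simp add: vec_eq_iff)
  then show "\<exists>x w. M = outer_prod x w" by blast
qed

lemma rank_le_one_outer_prod_add:
  fixes x y :: "'a::{finite,field}^'n"
  assumes "rank (outer_prod x w + outer_prod y z) \<le> 1"
  shows "parallel x y \<or> parallel w z"
proof (rule ccontr)
  assume "\<not> (parallel x y \<or> parallel w z)"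
  then obtain i k j l where "x$i * y$k \<noteq> x$k * y$i" and "w$j * z$l \<noteq> w$l * z$j"
    unfolding parallel_def by blast
  then have "(x$i * y$k - x$k * y$i) * (w$j * z$l - w$l * z$j) \<noteq> 0" by simp
  moreover obtain a b where ab: "outer_prod x w + outer_prod y z = outer_prod a b"
    using assms rank_le_one_iff by blast
  let ?M = "outer_prod x w + outer_prod y z"
  have "?M$i$j * ?M$k$l = ?M$i$l * ?M$k$j" unfolding ab by (simp add: mult_ac)
  ultimately show False by (simp add: algebra_simps)
qed

lemma parallel_sym: "parallel x y \<Longrightarrow> parallel y x"
  unfolding parallel_def by (metis mult.commute)

lemma parallel_imp_scaled:
  assumes "x \<noteq> 0" "parallel x y" obtains c where "y = c *s x"
proof -
  obtain k where k: "x$k \<noteq> 0" using assms(1) by (auto simp: vec_eq_iff)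
  have "y = (y$k / x$k) *s x" using assms(2) k unfolding parallel_def
    by (auto simp: vec_eq_iff field_simps)
  then show ?thesis using that by blast
qed

lemma parallel_trans:
  assumes "y \<noteq> 0" "parallel x y" "parallel y z" shows "parallel x z"
proof -
  obtain s where "x = s *s y" using parallel_imp_scaled assms(1,2) parallel_sym by metis
  moreover obtain t where "z = t *s y" using parallel_imp_scaled assms(1,3) by metis
  ultimately show ?thesis unfolding parallel_def by (simp add: algebra_simps)
qed

lemma exists_not_parallel:
  fixes x :: "'a::field^'n"
  assumes "x \<noteq> 0" "2 \<le> CARD('n)" obtains y where "\<not> parallel x y"
proof -
  obtain k where k: "x$k \<noteq> 0" using assms(1) by (auto simp: vec_eq_iff)
  have "card (UNIV - {k}) \<noteq> 0" using assms(2) by (simp add: card_Diff_singleton)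
  then obtain j where "j \<in> UNIV - {k}" by (metis card.empty ex_in_conv)
  then have j: "j \<noteq> k" by simp
  have "\<not> parallel x (axis j 1)"
  proof
    assume "parallel x (axis j 1)"
    then have "x$k * axis j 1 $ j = x$j * axis j 1 $ k" unfolding parallel_def by blast
    then show False using k j by (simp add: axis_def)
  qed
  then show ?thesis using that by blast
qed

lemma outer_prod_in_left_outers [simp]: "outer_prod u w \<in> left_outers u"
  by (simp add: left_outers_def)

lemma outer_prod_in_right_outers [simp]: "outer_prod x w \<in> right_outers w"
  by (simp add: right_outers_def)

lemma left_outers_0 [simp]: "left_outers 0 = {0}"
  by (auto simp: left_outers_def vec_eq_iff)

lemma right_outers_0 [simp]: "right_outers 0 = {0}"
  by (auto simp: right_outers_def vec_eq_iff)

lemma zero_in_left_outers [simp]: "0 \<in> left_outers u"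
  using outer_prod_in_left_outers[of u 0] by simp

lemma zero_in_right_outers [simp]: "0 \<in> right_outers w"
  using outer_prod_in_right_outers[of 0 w] by simp

lemma left_outers_add: "a \<in> left_outers u \<Longrightarrow> b \<in> left_outers u \<Longrightarrow> a + b \<in> left_outers u"
  by (auto simp: left_outers_def outer_prod_add_right[symmetric])

lemma right_outers_add: "a \<in> right_outers w \<Longrightarrow> b \<in> right_outers w \<Longrightarrow> a + b \<in> right_outers w"
  by (auto simp: right_outers_def outer_prod_add_left[symmetric])

lemma rank_le_one_if_left_outers: "M \<in> left_outers u \<Longrightarrow> rank (M::'a::{finite,field}^'m^'n) \<le> 1"
  unfolding left_outers_def by (metis rangeE rank_le_one_iff)

lemma rank_le_one_if_right_outers: "M \<in> right_outers w \<Longrightarrow> rank (M::'a::{finite,field}^'m^'n) \<le> 1"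
  unfolding right_outers_def by (metis rangeE rank_le_one_iff)

lemma left_outers_subset_if_eq:
  fixes a c :: "'a::field^'n"
  assumes "outer_prod a p = outer_prod c q" "outer_prod a p \<noteq> 0"
  shows "(left_outers a :: ('a^'k^'n) set) \<subseteq> left_outers c"
proof -
  obtain j where j: "p$j \<noteq> 0" using assms(2) by (auto simp: vec_eq_iff)
  have "a$i * p$j = c$i * q$j" for i using assms(1) by (metis outer_prod_nth)
  then have "a = (q$j / p$j) *s c" using j by (auto simp: vec_eq_iff field_simps)
  then have "outer_prod a v = outer_prod c ((q$j / p$j) *s v)" for v :: "'a^'k" by (simp add: vec_eq_iff)
  then show ?thesis by (auto simp: left_outers_def)
qed

lemma image_transpose_left_outers: "transpose ` left_outers u = right_outers u"
  by (auto simp: left_outers_def right_outers_def transpose_outer_prod image_iff)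

lemma image_transpose_right_outers: "transpose ` right_outers w = left_outers w"
  by (auto simp: left_outers_def right_outers_def transpose_outer_prod image_iff)

lemma card_left_outers_le:
  "card (left_outers u :: ('a::{finite,field}^'m^'n) set) \<le> CARD('a) ^ CARD('m)"
  unfolding left_outers_def by (metis card_image_le finite CARD_vec)

lemma card_left_outers:
  fixes u :: "'a::{finite,field}^'n"
  assumes "u \<noteq> 0" shows "card (left_outers u :: ('a^'m^'n) set) = CARD('a) ^ CARD('m)"
  unfolding left_outers_def by (simp add: card_image inj_outer_prod_right[OF assms])

lemma additive_rank_one_dichotomy:
  fixes S :: "('a::{finite,field}^'m^'n) set"
  assumes rank: "\<And>M. M \<in> S \<Longrightarrow> rank M \<le> 1"
    and add: "\<And>a b. a \<in> S \<Longrightarrow> b \<in> S \<Longrightarrow> a + b \<in> S"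
  shows "(\<exists>u. S \<subseteq> left_outers u) \<or> (\<exists>w. S \<subseteq> right_outers w)"
proof (rule ccontr)
  assume "\<not> ?thesis"
  then have "S \<noteq> {0}" "S \<noteq> {}" using left_outers_0 by blast+
  then obtain A where A: "A \<in> S" "A \<noteq> 0" by blast
  have outer: "\<exists>x w. M = outer_prod x w" if "M \<in> S" for M using rank that rank_le_one_iff by blast
  obtain u w where A_eq: "A = outer_prod u w" using outer A(1) by blast
  then have "u \<noteq> 0" "w \<noteq> 0" using A(2) by auto
  from \<open>\<not> ?thesis\<close> obtain B1 B2 where B1: "B1 \<in> S" "B1 \<notin> left_outers u"
    and B2: "B2 \<in> S" "B2 \<notin> right_outers w" by blast
  obtain x1 z1 where B1_eq: "B1 = outer_prod x1 z1" using outer B1(1) by blast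
  obtain x2 z2 where B2_eq: "B2 = outer_prod x2 z2" using outer B2(1) by blast
  have not_ux1: "\<not> parallel u x1"
  proof
    assume "parallel u x1"
    then obtain c where "x1 = c *s u" using parallel_imp_scaled \<open>u \<noteq> 0\<close> by blast
    then have "B1 = outer_prod u (c *s z1)" using B1_eq by (simp add: vec_eq_iff)
    then show False using B1(2) by simp
  qed
  have not_wz2: "\<not> parallel w z2"
  proof
    assume "parallel w z2"
    then obtain c where "z2 = c *s w" using parallel_imp_scaled \<open>w \<noteq> 0\<close> by blast
    then have "B2 = outer_prod (c *s x2) w" using B2_eq by (simp add: vec_eq_iff)
    then show False using B2(2) by simp
  qed
  have wz1: "parallel w z1"
    using rank_le_one_outer_prod_add[of u w x1 z1] not_ux1 rank add A(1) B1(1) A_eq B1_eq by auto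
  have ux2: "parallel u x2"
    using rank_le_one_outer_prod_add[of u w x2 z2] not_wz2 rank add A(1) B2(1) A_eq B2_eq by auto
  have "x2 \<noteq> 0" "z1 \<noteq> 0" using B1 B2 B1_eq B2_eq by auto
  have "parallel x1 x2 \<or> parallel z1 z2"
    using rank_le_one_outer_prod_add[of x1 z1 x2 z2] rank add B1(1) B2(1) B1_eq B2_eq by auto
  then show False
  proof
    assume "parallel x1 x2"
    then have "parallel u x1" using parallel_trans[OF \<open>x2 \<noteq> 0\<close> ux2] parallel_sym by blast
    then show False using not_ux1 by blast
  next
    assume "parallel z1 z2"
    then have "parallel w z2" using parallel_trans[OF \<open>z1 \<noteq> 0\<close> wz1] by blast
    then show False using not_wz2 by blast
  qed
qed

section \<open>Linear maps preserving rank one\<close>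

definition preserves_outers :: "('a::field^'m^'n \<Rightarrow> 'a^'m2^'n2) \<Rightarrow> bool" where
  "preserves_outers f \<longleftrightarrow> (\<forall>u. \<exists>a. f ` left_outers u \<subseteq> left_outers a) \<and>
     (\<forall>w. \<exists>b. f ` right_outers w \<subseteq> right_outers b)"

lemma linear_transpose:
  "Vector_Spaces.linear mat_scale mat_scale (transpose :: 'a::field^'m^'n \<Rightarrow> 'a^'n^'m)"
  unfolding Vector_Spaces.linear_iff
  by (intro conjI mat.vector_space_axioms allI) (simp_all add: vec_eq_iff transpose_def mat_scale_def)

lemma inj_matrix_transpose: "inj transpose"
  by (rule inj_on_inverseI[where g = transpose]) (rule transpose_transpose)

lemma image_transpose_comp_subset_iff: "(transpose \<circ> g) ` X \<subseteq> transpose ` Y \<longleftrightarrow> g ` X \<subseteq> Y"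
  unfolding image_comp[symmetric] by (rule inj_image_subset_iff[OF inj_matrix_transpose])

lemma image_transpose_comp_subset_outers_iff:
  "(transpose \<circ> g) ` X \<subseteq> left_outers a \<longleftrightarrow> g ` X \<subseteq> right_outers a"
  "(transpose \<circ> g) ` X \<subseteq> right_outers b \<longleftrightarrow> g ` X \<subseteq> left_outers b"
  using image_transpose_comp_subset_iff[of g X "right_outers a"]
    image_transpose_comp_subset_iff[of g X "left_outers b"]
  by (simp_all only: image_transpose_left_outers image_transpose_right_outers)

lemma preserves_outers_transpose_conj:
  assumes "preserves_outers g" shows "preserves_outers (transpose \<circ> g \<circ> transpose)"
proof -
  have conj: "(transpose \<circ> g \<circ> transpose) ` X = (transpose \<circ> g) ` transpose ` X" for X
    by (simp add: image_comp)
  show ?thesis using assms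
    unfolding preserves_outers_def conj image_transpose_left_outers image_transpose_right_outers
      image_transpose_comp_subset_outers_iff by blast
qed

lemma rank_le_one_transpose:
  assumes "rank (M::'a::{finite,field}^'m^'n) \<le> 1" shows "rank (transpose M) \<le> 1"
proof -
  obtain x w where "M = outer_prod x w" using assms rank_le_one_iff by blast
  then have "transpose M = outer_prod w x" by (simp add: transpose_outer_prod)
  then show ?thesis using rank_le_one_iff by blast
qed

lemma rank_le_one_transpose_iff:
  "rank (transpose M) \<le> 1 \<longleftrightarrow> rank (M::'a::{finite,field}^'m^'n) \<le> 1"
proof
  assume "rank (transpose M) \<le> 1"
  then show "rank M \<le> 1" using rank_le_one_transpose[of "transpose M"] by simp
qed (rule rank_le_one_transpose)

locale rank_one_preserver =
  fixes f :: "'a::{finite,field}^'m^'n \<Rightarrow> 'a^'m2^'n2"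
  assumes linear: "Vector_Spaces.linear mat_scale mat_scale f"
    and inj: "inj f"
    and rank_le_one: "\<And>M. rank (f M) \<le> 1 \<longleftrightarrow> rank M \<le> 1"
begin

lemma eq_0_iff: "f M = 0 \<longleftrightarrow> M = 0"
  using inj mat.linear_0[OF linear] by (metis injD)

lemma transpose_comp: "rank_one_preserver (transpose \<circ> f)"
proof (rule rank_one_preserver.intro)
  show "Vector_Spaces.linear mat_scale mat_scale (transpose \<circ> f)"
    by (rule Vector_Spaces.linear_compose[OF linear linear_transpose])
  show "inj (transpose \<circ> f)" by (rule inj_compose[OF inj_matrix_transpose inj])
  show "rank ((transpose \<circ> f) M) \<le> 1 \<longleftrightarrow> rank M \<le> 1" for M
    by (simp only: comp_apply rank_le_one_transpose_iff rank_le_one)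
qed

lemma image_additive_rank_one_dichotomy:
  assumes "\<And>M. M \<in> S \<Longrightarrow> rank M \<le> 1" and "\<And>a b. a \<in> S \<Longrightarrow> b \<in> S \<Longrightarrow> a + b \<in> S"
  shows "(\<exists>a. f ` S \<subseteq> left_outers a) \<or> (\<exists>b. f ` S \<subseteq> right_outers b)"
proof (rule additive_rank_one_dichotomy)
  show "rank M \<le> 1" if "M \<in> f ` S" for M using that assms(1) rank_le_one by auto
  show "a + b \<in> f ` S" if a: "a \<in> f ` S" and b: "b \<in> f ` S" for a b
  proof -
    obtain x y where "x \<in> S" "y \<in> S" "a = f x" "b = f y" using a b by blast
    then have "a + b = f (x + y)" by (simp add: mat.linear_add[OF linear])
    with \<open>x \<in> S\<close> \<open>y \<in> S\<close> assms(2) show ?thesis by blast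
  qed
qed

lemma image_left_outers_dichotomy:
  "(\<exists>a. f ` left_outers u \<subseteq> left_outers a) \<or> (\<exists>b. f ` left_outers u \<subseteq> right_outers b)"
  by (rule image_additive_rank_one_dichotomy[OF rank_le_one_if_left_outers left_outers_add])

lemma image_right_outers_dichotomy:
  "(\<exists>a. f ` right_outers w \<subseteq> left_outers a) \<or> (\<exists>b. f ` right_outers w \<subseteq> right_outers b)"
  by (rule image_additive_rank_one_dichotomy[OF rank_le_one_if_right_outers right_outers_add])

context
  assumes card_rows: "2 \<le> CARD('n)" and card_cols: "2 \<le> CARD('m)"
begin

lemma not_left_and_right_outers_into_left_outers:
  assumes u: "u \<noteq> 0" and w: "w \<noteq> 0"
    and left: "f ` left_outers u \<subseteq> left_outers a" and right: "f ` right_outers w \<subseteq> left_outers c"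
  shows False
proof -
  \<comment> \<open>both families contain the nonzero image of u w^T, so they land in one left_outers c;
    but u z^T + x w^T has rank two while its image would lie in left_outers c\<close>
  have "f (outer_prod u w) \<noteq> 0" using u w by (simp add: eq_0_iff)
  moreover obtain p where "f (outer_prod u w) = outer_prod a p"
    using left outer_prod_in_left_outers by (fastforce simp: left_outers_def)
  moreover obtain q where "f (outer_prod u w) = outer_prod c q"
    using right outer_prod_in_right_outers by (fastforce simp: left_outers_def)
  ultimately have "left_outers a \<subseteq> left_outers c" by (metis left_outers_subset_if_eq)
  with left have left': "f ` left_outers u \<subseteq> left_outers c" by blast
  obtain z where z: "\<not> parallel w z" using exists_not_parallel[OF w card_cols] by blast
  obtain x where x: "\<not> parallel u x" using exists_not_parallel[OF u card_rows] by blast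
  have "f (outer_prod u z) \<in> left_outers c" using left' by (simp add: image_subset_iff)
  moreover have "f (outer_prod x w) \<in> left_outers c" using right by (simp add: image_subset_iff)
  ultimately have "f (outer_prod u z) + f (outer_prod x w) \<in> left_outers c" by (rule left_outers_add)
  then have "rank (f (outer_prod u z + outer_prod x w)) \<le> 1"
    unfolding mat.linear_add[OF linear] by (rule rank_le_one_if_left_outers)
  then have "parallel u x \<or> parallel z w"
    unfolding rank_le_one by (rule rank_le_one_outer_prod_add)
  then show False using x z parallel_sym by blast
qed

lemma image_left_outers_left_iff_image_right_outers_right:
  assumes u: "u \<noteq> 0" and w: "w \<noteq> 0"
  shows "(\<exists>a. f ` left_outers u \<subseteq> left_outers a) \<longleftrightarrow> (\<exists>b. f ` right_outers w \<subseteq> right_outers b)"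
proof
  assume "\<exists>a. f ` left_outers u \<subseteq> left_outers a"
  then obtain a where "f ` left_outers u \<subseteq> left_outers a" by blast
  then have "\<not> f ` right_outers w \<subseteq> left_outers c" for c
    using not_left_and_right_outers_into_left_outers[OF u w] by blast
  then show "\<exists>b. f ` right_outers w \<subseteq> right_outers b"
    using image_right_outers_dichotomy by blast
next
  assume "\<exists>b. f ` right_outers w \<subseteq> right_outers b"
  then obtain b where "f ` right_outers w \<subseteq> right_outers b" by blast
  then have "(transpose \<circ> f) ` right_outers w \<subseteq> left_outers b"
    by (simp only: image_transpose_comp_subset_outers_iff)
  then have "\<not> (transpose \<circ> f) ` left_outers u \<subseteq> left_outers a" for a
    using rank_one_preserver.not_left_and_right_outers_into_left_outers[OF transpose_comp
        card_rows card_cols u w] by blast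
  then have "\<not> f ` left_outers u \<subseteq> right_outers a" for a
    by (simp only: image_transpose_comp_subset_outers_iff not_False_eq_True)
  then show "\<exists>a. f ` left_outers u \<subseteq> left_outers a"
    using image_left_outers_dichotomy by blast
qed

lemma preserves_outers_or_transpose_comp:
  "preserves_outers f \<or> preserves_outers (transpose \<circ> f)"
proof -
  define u0 :: "'a^'n" where "u0 = axis undefined 1"
  define w0 :: "'a^'m" where "w0 = axis undefined 1"
  have u0: "u0 \<noteq> 0" and w0: "w0 \<noteq> 0" by (simp_all add: u0_def w0_def)
  note iff = image_left_outers_left_iff_image_right_outers_right
  note f0 = mat.linear_0[OF linear]
  show ?thesis
  proof (cases "\<exists>a. f ` left_outers u0 \<subseteq> left_outers a")
    case True
    then have right: "\<exists>b. f ` right_outers w \<subseteq> right_outers b" for w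
      using iff[OF u0, of w] by (cases "w = 0") (auto simp: f0)
    then have "\<exists>a. f ` left_outers u \<subseteq> left_outers a" for u
      using iff[OF _ w0, of u] by (cases "u = 0") (auto simp: f0)
    with right show ?thesis unfolding preserves_outers_def by blast
  next
    case False
    then have "\<exists>a. f ` right_outers w \<subseteq> left_outers a" for w
      using iff[OF u0, of w] image_right_outers_dichotomy[of w] by (cases "w = 0") (auto simp: f0)
    moreover have "\<exists>b. f ` left_outers u \<subseteq> right_outers b" for u
      using iff[OF _ w0, of u] iff[OF u0 w0] False image_left_outers_dichotomy[of u]
      by (cases "u = 0") (auto simp: f0)
    ultimately show ?thesis
      unfolding preserves_outers_def image_transpose_comp_subset_outers_iff by blast
  qed
qed

end

end

lemma one_less_card_field: "1 < CARD('a::{finite,field})"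
proof -
  have "card {0::'a, 1} \<le> CARD('a)" by (rule card_mono) auto
  then show ?thesis by simp
qed

lemma preserves_outers_card_le:
  fixes g :: "'a::{finite,field}^'m^'n \<Rightarrow> 'a^'m2^'n2"
  assumes "inj g" and "preserves_outers g"
  shows "CARD('m) \<le> CARD('m2)"
proof -
  define u :: "'a^'n" where "u = axis undefined 1"
  have "u \<noteq> 0" by (simp add: u_def)
  obtain a where sub: "g ` left_outers u \<subseteq> left_outers a"
    using assms(2) unfolding preserves_outers_def by blast
  have "CARD('a) ^ CARD('m) = card (left_outers u :: ('a^'m^'n) set)"
    by (rule card_left_outers[OF \<open>u \<noteq> 0\<close>, symmetric])
  also have "\<dots> = card (g ` left_outers u)"
    by (rule card_image[OF inj_on_subset[OF assms(1)], symmetric]) simp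
  also have "\<dots> \<le> card (left_outers a :: ('a^'m2^'n2) set)" by (rule card_mono[OF finite sub])
  also have "\<dots> \<le> CARD('a) ^ CARD('m2)" by (rule card_left_outers_le)
  finally show ?thesis by (rule power_le_imp_le_exp[OF one_less_card_field])
qed

section \<open>Matrices with prescribed column space\<close>

definition mats_colsp_in :: "('a::field^'n) set \<Rightarrow> ('a^'m^'n) set" where
  "mats_colsp_in V = {M. \<forall>j. column j M \<in> V}"

lemma colsp_subset_iff: "vec.subspace V \<Longrightarrow> colsp M \<subseteq> V \<longleftrightarrow> M \<in> mats_colsp_in V"
  unfolding colsp_def mats_colsp_in_def
proof
  assume "vec.subspace V" "vec.span (columns M) \<subseteq> V"
  then show "M \<in> {M. \<forall>j. column j M \<in> V}"
    using vec.span_superset by (fastforce simp: columns_def)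
next
  assume "vec.subspace V" "M \<in> {M. \<forall>j. column j M \<in> V}"
  then show "vec.span (columns M) \<subseteq> V"
    by (intro vec.span_minimal) (auto simp: columns_def)
qed

lemma sum_outer_prod_columns: "(\<Sum>j\<in>UNIV. outer_prod (column j M) (axis j 1)) = M"
  by (simp add: vec_eq_iff column_def axis_def if_distrib cong: if_cong)

lemma mats_colsp_in_sum:
  assumes "vec.subspace V" and "\<And>j. j \<in> A \<Longrightarrow> X j \<in> mats_colsp_in V"
  shows "sum X A \<in> mats_colsp_in V"
proof -
  have "column l (sum X A) = (\<Sum>j\<in>A. column l (X j))" for l
    by (simp add: vec_eq_iff column_def)
  then show ?thesis using assms unfolding mats_colsp_in_def by (auto intro!: vec.subspace_sum)
qed

lemma left_outers_subset_mats_colsp_in: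
  assumes "vec.subspace V" and "u \<in> V" shows "left_outers u \<subseteq> mats_colsp_in V"
  using assms by (auto simp: left_outers_def mats_colsp_in_def column_outer_prod vec.subspace_scale)

lemma card_vec_set: "card {x :: 'b^'m. \<forall>j. x$j \<in> V} = card V ^ CARD('m)"
proof -
  have "bij_betw vec_nth {x :: 'b^'m. \<forall>j. x$j \<in> V} (Pi\<^sub>E UNIV (\<lambda>_. V))"
  proof (rule bij_betw_byWitness[where f' = vec_lambda])
    show "vec_nth ` {x :: 'b^'m. \<forall>j. x$j \<in> V} \<subseteq> Pi\<^sub>E UNIV (\<lambda>_. V)" by auto
    show "vec_lambda ` Pi\<^sub>E UNIV (\<lambda>_. V) \<subseteq> {x :: 'b^'m. \<forall>j. x$j \<in> V}" by auto
  qed (simp_all add: vec_lambda_inverse)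
  then show ?thesis by (simp add: bij_betw_same_card card_PiE)
qed

lemma card_mats_colsp_in: "card (mats_colsp_in V :: ('a::field^'m^'n) set) = card V ^ CARD('m)"
proof -
  have "mats_colsp_in V = transpose ` {N :: 'a^'n^'m. \<forall>j. N$j \<in> V}"
  proof -
    have "mats_colsp_in V = {M. transpose M \<in> {N :: 'a^'n^'m. \<forall>j. N$j \<in> V}}"
      unfolding mats_colsp_in_def column_def transpose_def by simp
    also have "\<dots> = transpose ` {N :: 'a^'n^'m. \<forall>j. N$j \<in> V}"
      by (auto simp: image_iff) (metis transpose_transpose)
    finally show ?thesis .
  qed
  then show ?thesis by (simp add: card_image inj_on_subset[OF inj_matrix_transpose] card_vec_set)
qed

lemma linear_into_right_outers:
  fixes h :: "'a::field^'k \<Rightarrow> 'a^'m^'n"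
  assumes lin: "Vector_Spaces.linear (*s) mat_scale h"
    and into: "\<And>x. h x \<in> right_outers w" and w: "w \<noteq> 0"
  obtains \<psi> :: "'a^'k \<Rightarrow> 'a^'n"
  where "Vector_Spaces.linear (*s) (*s) \<psi>" and "\<And>x. h x = outer_prod (\<psi> x) w"
proof -
  obtain j where j: "w$j \<noteq> 0" using w by (auto simp: vec_eq_iff)
  define \<psi> where "\<psi> x = (\<chi> i. h x $ i $ j / w$j)" for x
  have h: "h x = outer_prod (\<psi> x) w" for x
  proof -
    obtain y where "h x = outer_prod y w" using into[of x] by (auto simp: right_outers_def)
    then show ?thesis using j by (simp add: \<psi>_def vec_eq_iff)
  qed
  have add: "h (x + y) = h x + h y" and scale: "h (c *s x) = mat_scale c (h x)" for x y c
    using lin by (simp_all add: Vector_Spaces.linear_iff)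
  have "Vector_Spaces.linear (*s) (*s) \<psi>"
    unfolding Vector_Spaces.linear_iff
    by (intro conjI vec.vector_space_axioms allI)
      (simp_all add: \<psi>_def add scale vec_eq_iff mat_scale_def add_divide_distrib)
  with h show ?thesis using that by blast
qed

lemma preserves_outers_left_factor:
  fixes k :: "'a::field^'m^'n \<Rightarrow> 'a^'m2^'n2"
  assumes lin: "Vector_Spaces.linear mat_scale mat_scale k" and inj: "inj k"
    and pres: "preserves_outers k"
  obtains \<psi> :: "'a^'n \<Rightarrow> 'a^'n2" where "Vector_Spaces.linear (*s) (*s) \<psi>" and "inj \<psi>"
    and "\<And>u. k ` left_outers u \<subseteq> left_outers (\<psi> u)"
proof -
  have k_eq_0: "k M = 0 \<longleftrightarrow> M = 0" for M
    using inj mat.linear_0[OF lin] by (metis injD)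
  define w0 :: "'a^'m" where "w0 = axis undefined 1"
  have w0: "w0 \<noteq> 0" by (simp add: w0_def)
  obtain w where w: "k ` right_outers w0 \<subseteq> right_outers w"
    using pres unfolding preserves_outers_def by blast
  have into: "k (outer_prod u w0) \<in> right_outers w" for u
    using w by (simp add: image_subset_iff)
  have "w \<noteq> 0"
  proof
    assume "w = 0"
    then have "k (outer_prod (axis undefined 1 :: 'a^'n) w0) = 0" using into by simp
    then show False using w0 by (simp add: k_eq_0)
  qed
  moreover have "Vector_Spaces.linear (*s) mat_scale (\<lambda>u. k (outer_prod u w0))"
    using Vector_Spaces.linear_compose[OF linear_outer_prod_left lin] by (simp add: comp_def)
  ultimately obtain \<psi> where lin_\<psi>: "Vector_Spaces.linear (*s) (*s) \<psi>"
    and \<psi>: "\<And>u. k (outer_prod u w0) = outer_prod (\<psi> u) w"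
    using into linear_into_right_outers by blast
  have "inj \<psi>"
  proof (rule injI)
    fix u v assume "\<psi> u = \<psi> v"
    then have "k (outer_prod u w0) = k (outer_prod v w0)" by (simp add: \<psi>)
    then have "outer_prod u w0 = outer_prod v w0" by (rule injD[OF inj])
    then show "u = v" using injD[OF inj_outer_prod_left[OF w0], of u v] by simp
  qed
  moreover have "k ` left_outers u \<subseteq> left_outers (\<psi> u)" for u
  proof (cases "u = 0")
    case True
    then show ?thesis by (simp add: mat.linear_0[OF lin])
  next
    case False
    obtain a where a: "k ` left_outers u \<subseteq> left_outers a"
      using pres unfolding preserves_outers_def by blast
    then obtain p where "k (outer_prod u w0) = outer_prod a p"
      by (auto simp: image_subset_iff left_outers_def)
    moreover have "k (outer_prod u w0) \<noteq> 0" using False w0 by (simp add: k_eq_0)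
    ultimately have "left_outers a \<subseteq> (left_outers (\<psi> u) :: ('a^'m2^'n2) set)"
      using left_outers_subset_if_eq[of a p "\<psi> u" w] \<psi> by simp
    with a show ?thesis by blast
  qed
  ultimately show ?thesis using that lin_\<psi> by blast
qed

lemma image_mats_colsp_in:
  fixes k :: "'a::{finite,field}^'m^'n \<Rightarrow> 'a^'m2^'n2" and \<psi> :: "'a^'n \<Rightarrow> 'a^'n2"
  assumes lin: "Vector_Spaces.linear mat_scale mat_scale k" and inj: "inj k"
    and cols: "CARD('m) = CARD('m2)"
    and lin_\<psi>: "Vector_Spaces.linear (*s) (*s) \<psi>" and inj_\<psi>: "inj \<psi>"
    and factor: "\<And>u. k ` left_outers u \<subseteq> left_outers (\<psi> u)"
    and V: "vec.subspace V"
  shows "k ` mats_colsp_in V = mats_colsp_in (\<psi> ` V)"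
proof (rule card_subset_eq)
  have W: "vec.subspace (\<psi> ` V)" by (rule vec.linear_subspace_image[OF lin_\<psi> V])
  show "k ` mats_colsp_in V \<subseteq> mats_colsp_in (\<psi> ` V)"
  proof
    fix N assume "N \<in> k ` mats_colsp_in V"
    then obtain M where M: "M \<in> mats_colsp_in V" and N: "N = k M" by blast
    have "N = (\<Sum>j\<in>UNIV. k (outer_prod (column j M) (axis j 1)))"
      unfolding N by (subst sum_outer_prod_columns[symmetric]) (rule mat.linear_sum[OF lin])
    also have "\<dots> \<in> mats_colsp_in (\<psi> ` V)"
    proof (rule mats_colsp_in_sum[OF W])
      fix j
      have "\<psi> (column j M) \<in> \<psi> ` V" using M by (simp add: mats_colsp_in_def)
      moreover have "k (outer_prod (column j M) (axis j 1)) \<in> left_outers (\<psi> (column j M))"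
        using factor[of "column j M"] by (simp add: image_subset_iff)
      ultimately show "k (outer_prod (column j M) (axis j 1)) \<in> mats_colsp_in (\<psi> ` V)"
        using left_outers_subset_mats_colsp_in[OF W] by blast
    qed
    finally show "N \<in> mats_colsp_in (\<psi> ` V)" .
  qed
  have "card (k ` mats_colsp_in V) = card V ^ CARD('m)"
    by (simp add: card_image inj_on_subset[OF inj] card_mats_colsp_in)
  also have "\<dots> = card (mats_colsp_in (\<psi> ` V) :: ('a^'m2^'n2) set)"
    by (simp add: card_image inj_on_subset[OF inj_\<psi>] card_mats_colsp_in cols)
  finally show "card (k ` mats_colsp_in V) = card (mats_colsp_in (\<psi> ` V) :: ('a^'m2^'n2) set)" .
qed simp

section \<open>The column and row q-polymatroids\<close>

lemma orth_subspace: "vec.subspace (orth J)"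
  unfolding vec.subspace_def orth_def dotp_def
  by (auto simp: sum.distrib distrib_left mult.left_commute simp flip: sum_distrib_left)

lemma dotp_axis: "dotp x (axis i 1) = x$i"
  by (simp add: dotp_def axis_def if_distrib cong: if_cong)

lemma dotp_transpose_mult: "dotp (transpose Q *v u) v = dotp u (Q *v v)"
proof -
  have "dotp (transpose Q *v u) v = (\<Sum>k\<in>UNIV. \<Sum>i\<in>UNIV. Q$i$k * u$i * v$k)"
    by (simp add: dotp_def matrix_vector_mult_def transpose_def sum_distrib_right)
  also have "\<dots> = (\<Sum>i\<in>UNIV. \<Sum>k\<in>UNIV. u$i * (Q$i$k * v$k))"
    by (subst sum.swap) (simp add: mult_ac)
  also have "\<dots> = dotp u (Q *v v)"
    by (simp add: dotp_def matrix_vector_mult_def sum_distrib_left)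
  finally show ?thesis .
qed

lemma orth_image_adjoint:
  fixes \<psi> :: "'a::{finite,field}^'n \<Rightarrow> 'a^'n2"
  assumes lin: "Vector_Spaces.linear (*s) (*s) \<psi>" and inj: "inj \<psi>" and dim: "CARD('n) = CARD('n2)"
  obtains \<phi> :: "'a^'n \<Rightarrow> 'a^'n2"
  where "Vector_Spaces.linear (*s) (*s) \<phi>" and "bij \<phi>" and "\<And>A. orth (\<phi> ` A) = \<psi> ` orth A"
proof -
  have dims: "vec.dim (UNIV :: ('a^'n2) set) = vec.dim (UNIV :: ('a^'n) set)"
    using dim by (simp only: vec_dim_card)
  obtain \<psi>' where lin': "Vector_Spaces.linear (*s) (*s) \<psi>'"
    and inv: "\<And>x. \<psi>' (\<psi> x) = x" "\<And>y. \<psi> (\<psi>' y) = y"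
    using vec.linear_injective_isomorphism[OF lin inj dims] by blast
  define \<phi> where "\<phi> u = transpose (matrix \<psi>') *v u" for u
  have dot: "dotp (\<phi> u) v = dotp u (\<psi>' v)" for u v
    by (simp only: \<phi>_def dotp_transpose_mult matrix_works[OF lin'])
  have lin_\<phi>: "Vector_Spaces.linear (*s) (*s) \<phi>"
    unfolding \<phi>_def by (rule matrix_vector_mul_linear_gen)
  have "inj \<phi>"
  proof (rule injI)
    fix a b assume "\<phi> a = \<phi> b"
    then have "dotp a (\<psi>' (\<psi> (axis i 1))) = dotp b (\<psi>' (\<psi> (axis i 1)))" for i by (simp flip: dot)
    then show "a = b" by (simp add: inv dotp_axis vec_eq_iff)
  qed
  then have "bij \<phi>"
    using vec.linear_injective_imp_surjective[OF lin_\<phi> _ dims] by (simp add: bij_def)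
  moreover have "orth (\<phi> ` A) = \<psi> ` orth A" for A
  proof -
    have "orth (\<phi> ` A) = {v. \<psi>' v \<in> orth A}" by (simp add: orth_def dot)
    also have "\<dots> = \<psi> ` orth A"
    proof
      show "{v. \<psi>' v \<in> orth A} \<subseteq> \<psi> ` orth A"
      proof
        fix v assume "v \<in> {v. \<psi>' v \<in> orth A}"
        then show "v \<in> \<psi> ` orth A" using image_eqI[of v \<psi> "\<psi>' v"] inv(2) by simp
      qed
    qed (auto simp: inv)
    finally show ?thesis .
  qed
  ultimately show ?thesis using that lin_\<phi> by blast
qed

lemma sub_c_eq_Int_mats_colsp_in: "vec.subspace V \<Longrightarrow> sub_c C V = C \<inter> mats_colsp_in V"
  by (auto simp: sub_c_def colsp_subset_iff)

lemma mat_dim_image: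
  fixes f :: "'a::{finite,field}^'m^'n \<Rightarrow> 'a^'m2^'n2"
  assumes lin: "Vector_Spaces.linear mat_scale mat_scale f" and inj: "inj f"
  shows "mat_dim (f ` S) = mat_dim S"
proof -
  obtain B :: "('a^'m^'n) set" where "B \<subseteq> UNIV" and B: "mat.independent B" "UNIV \<subseteq> mat.span B"
    and "card B = mat.dim (UNIV :: ('a^'m^'n) set)"
    by (rule mat.basis_exists)
  have "finite_dimensional_vector_space mat_scale B"
    by (intro finite_dimensional_vector_space.intro mat.vector_space_axioms
        finite_dimensional_vector_space_axioms.intro) (use B in auto)
  then have "finite_dimensional_vector_space_pair_1 mat_scale B
      (mat_scale :: 'a \<Rightarrow> 'a^'m2^'n2 \<Rightarrow> _)"
    by (intro finite_dimensional_vector_space_pair_1.intro mat.vector_space_axioms)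
  then show ?thesis unfolding mat_dim_def
    by (rule finite_dimensional_vector_space_pair_1.dim_image_eq[OF _ lin inj_on_subset[OF inj subset_UNIV]])
qed

lemma rank_isometry_rank_one_preserver:
  fixes f :: "'a::{finite,field}^'m^'n \<Rightarrow> 'a^'m2^'n2"
  assumes lin: "Vector_Spaces.linear mat_scale mat_scale f"
    and isometry: "\<forall>M N. rank (f M - f N) = rank (M - N)"
  shows "rank_one_preserver f"
proof (rule rank_one_preserver.intro)
  have rank: "rank (f M) = rank M" for M
    using isometry[rule_format, of M 0] by (simp add: mat.linear_0[OF lin])
  show "Vector_Spaces.linear mat_scale mat_scale f" by (rule lin)
  show "inj f"
  proof (rule injI)
    fix M N assume "f M = f N"
    then have "rank (M - N) = 0"
      using isometry[rule_format, of M N] rank_eq_0_iff[of "0 :: 'a^'m2^'n2"] by simp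
    then show "M = N" by (simp add: rank_eq_0_iff)
  qed
  show "rank (f M) \<le> 1 \<longleftrightarrow> rank M \<le> 1" for M by (simp only: rank)
qed

lemma qpm_equiv_rho_c_image:
  fixes k :: "'a::{finite,field}^'m^'n \<Rightarrow> 'a^'m2^'n2"
  assumes lin: "Vector_Spaces.linear mat_scale mat_scale k" and inj: "inj k"
    and cols: "CARD('m) = CARD('m2)" and rows: "CARD('n) = CARD('n2)"
    and pres: "preserves_outers k"
  shows "qpm_equiv (rho_c C) (rho_c (k ` C))"
proof -
  obtain \<psi> :: "'a^'n \<Rightarrow> 'a^'n2" where lin_\<psi>: "Vector_Spaces.linear (*s) (*s) \<psi>"
    and "inj \<psi>" and factor: "\<And>u. k ` left_outers u \<subseteq> left_outers (\<psi> u)"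
    using preserves_outers_left_factor[OF lin inj pres] by blast
  obtain \<phi> :: "'a^'n \<Rightarrow> 'a^'n2" where "Vector_Spaces.linear (*s) (*s) \<phi>" and "bij \<phi>"
    and orth_\<phi>: "\<And>A. orth (\<phi> ` A) = \<psi> ` orth A"
    using orth_image_adjoint[OF lin_\<psi> \<open>inj \<psi>\<close> rows] by blast
  have "sub_c (k ` C) (orth (\<phi> ` A)) = k ` sub_c C (orth A)" for A
  proof -
    have "vec.subspace (\<psi> ` orth A)" by (rule vec.linear_subspace_image[OF lin_\<psi> orth_subspace])
    then have "sub_c (k ` C) (orth (\<phi> ` A)) = k ` C \<inter> mats_colsp_in (\<psi> ` orth A)"
      by (simp add: orth_\<phi> sub_c_eq_Int_mats_colsp_in)
    also have "\<dots> = k ` C \<inter> k ` mats_colsp_in (orth A)"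
      by (simp add: image_mats_colsp_in[OF lin inj cols lin_\<psi> \<open>inj \<psi>\<close> factor orth_subspace])
    also have "\<dots> = k ` sub_c C (orth A)"
      by (simp add: image_Int[OF inj] sub_c_eq_Int_mats_colsp_in[OF orth_subspace])
    finally show ?thesis .
  qed
  then have "rho_c C A = rho_c (k ` C) (\<phi> ` A)" for A
    by (simp add: rho_c_def mat_dim_image[OF lin inj] cols)
  then show ?thesis unfolding qpm_equiv_def using \<open>Vector_Spaces.linear (*s) (*s) \<phi>\<close> \<open>bij \<phi>\<close> by blast
qed

lemma rho_r_eq_rho_c_transpose: "rho_r (C :: ('a::{finite,field}^'m^'n) set) = rho_c (transpose ` C)"
proof
  fix K :: "('a^'m) set"
  have "sub_c (transpose ` C) (orth K) = transpose ` sub_r C (orth K)"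
    by (auto simp: sub_c_def sub_r_def rowsp_def colsp_def)
  then show "rho_r C K = rho_c (transpose ` C) K"
    by (simp add: rho_r_def rho_c_def mat_dim_image[OF linear_transpose inj_matrix_transpose])
qed

lemma qpm_equiv_rho_r_image:
  fixes k :: "'a::{finite,field}^'m^'n \<Rightarrow> 'a^'m2^'n2"
  assumes lin: "Vector_Spaces.linear mat_scale mat_scale k" and inj: "inj k"
    and cols: "CARD('m) = CARD('m2)" and rows: "CARD('n) = CARD('n2)"
    and pres: "preserves_outers k"
  shows "qpm_equiv (rho_r C) (rho_r (k ` C))"
proof -
  let ?k = "transpose \<circ> k \<circ> transpose :: 'a^'n^'m \<Rightarrow> 'a^'n2^'m2"
  have "Vector_Spaces.linear mat_scale mat_scale ?k"
    by (rule Vector_Spaces.linear_compose[OF linear_transpose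
          Vector_Spaces.linear_compose[OF lin linear_transpose]])
  moreover have "inj ?k" by (intro inj_compose inj_matrix_transpose inj)
  ultimately have "qpm_equiv (rho_c (transpose ` C)) (rho_c (?k ` transpose ` C))"
    by (rule qpm_equiv_rho_c_image[OF _ _ rows cols preserves_outers_transpose_conj[OF pres]])
  moreover have "?k ` transpose ` C = transpose ` k ` C" by (simp add: image_image)
  ultimately show ?thesis by (simp add: rho_r_eq_rho_c_transpose)
qed

theorem proposition5p7:
  fixes C1 C2 :: "('a::{finite,field}^'m^'n) set"
  assumes "2 \<le> CARD('n)" and "CARD('n) \<le> CARD('m)"
    and "rank_metric_code C1" and "rank_metric_code C2"
    and "code_equiv C1 C2"
  shows "(CARD('m) > CARD('n) \<longrightarrow>
            qpm_equiv (rho_c C1) (rho_c C2) \<and> qpm_equiv (rho_r C1) (rho_r C2))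
       \<and> (CARD('n) = CARD('m) \<longrightarrow>
            (qpm_equiv (rho_c C1) (rho_c C2) \<and> qpm_equiv (rho_r C1) (rho_r C2)) \<or>
            (qpm_equiv (rho_c C1) (rho_r C2) \<and> qpm_equiv (rho_r C1) (rho_c C2)))"
proof -
  obtain f :: "'a^'m^'n \<Rightarrow> 'a^'m^'n" where lin: "Vector_Spaces.linear mat_scale mat_scale f"
    and isometry: "\<forall>M N. rank (f M - f N) = rank (M - N)" and image: "f ` C1 = C2"
    using assms(5) unfolding code_equiv_def by blast
  interpret rank_one_preserver f by (rule rank_isometry_rank_one_preserver[OF lin isometry])
  note transposed = rank_one_preserver.linear[OF transpose_comp] rank_one_preserver.inj[OF transpose_comp]
  consider "preserves_outers f" | "preserves_outers (transpose \<circ> f)" "CARD('m) = CARD('n)"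
    using preserves_outers_or_transpose_comp preserves_outers_card_le[OF transposed(2)] assms(1,2) by fastforce
  then show ?thesis
  proof cases
    case 1
    then show ?thesis
      using qpm_equiv_rho_c_image[OF linear inj refl refl] qpm_equiv_rho_r_image[OF linear inj refl refl]
        image by blast
  next
    case 2
    have "(transpose \<circ> f) ` C1 = transpose ` C2" unfolding image[symmetric] by (simp add: image_comp)
    then have "qpm_equiv (rho_c C1) (rho_r C2)" and "qpm_equiv (rho_r C1) (rho_c C2)"
      using qpm_equiv_rho_c_image[OF transposed 2(2) 2(2)[symmetric] 2(1), of C1]
        qpm_equiv_rho_r_image[OF transposed 2(2) 2(2)[symmetric] 2(1), of C1]
      by (simp_all add: rho_r_eq_rho_c_transpose image_image)
    then show ?thesis using 2(2) by simp
  qed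
qed

end
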